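(* There exist infinitely many (pairwise non-isomorphic) finite posets $P=(X,\prec)$ of width three such that, for each of them, there are distinct elements $x,y,z\in X$ and integers $k\le p$, $\ell\le q$ with $$\mathrm{F}(k,\ell)\,\mathrm{F}(p,q)\ >\ \mathrm{F}(p,\ell)\,\mathrm{F}(k,q),$$ where for integers $a,b$ (not necessarily positive), $\mathrm{F}(a,b)$ is the number of linear extensions $L$ of $P$ with $L(y)-L(x)=a$ and $L(z)-L(y)=b$.
   Context: A linear extension of a finite poset $P=(X,\prec)$ with $|X|=n$ is a bijection $L:X\to\{1,\dots,n\}$ with $L(u)<L(v)$ whenever $u\prec v$. The width of a poset is the maximal size of an antichain. Here $\mathrm F(a,b)$ is defined for all integers $a,b$. *)

theory Defs
  imports Complex_Main "HOL-Library.FuncSet"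
begin

text \<open>A poset is a pair \<open>(X, r)\<close> of a ground set and a strict order on it:
  \<open>(u, v) \<in> r\<close> stands for \<open>u \<prec> v\<close>.\<close>

type_synonym 'a poset = "'a set \<times> 'a rel"

definition finite_poset :: "'a poset \<Rightarrow> bool" where
  "finite_poset P \<longleftrightarrow>
     (case P of (X, r) \<Rightarrow> finite X \<and> r \<subseteq> X \<times> X \<and> irrefl r \<and> trans r)"

definition poset_isomorphic :: "'a poset \<Rightarrow> 'b poset \<Rightarrow> bool" where
  "poset_isomorphic P Q \<longleftrightarrow>
     (\<exists>f. bij_betw f (fst P) (fst Q) \<and>
          (\<forall>u\<in>fst P. \<forall>v\<in>fst P. (u, v) \<in> snd P \<longleftrightarrow> (f u, f v) \<in> snd Q))"

definition antichains :: "'a poset \<Rightarrow> 'a set set" where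
  "antichains P = {A. A \<subseteq> fst P \<and> (\<forall>u\<in>A. \<forall>v\<in>A. (u, v) \<notin> snd P)}"

definition width :: "'a poset \<Rightarrow> nat" where
  "width P = Max (card ` antichains P)"

text \<open>Restricting to \<open>extensional\<close> functions makes a linear extension determined by its
  values on the ground set, so that the cardinality below counts maps on the ground set.\<close>

definition linear_extensions :: "'a poset \<Rightarrow> ('a \<Rightarrow> nat) set" where
  "linear_extensions P =
     {L \<in> extensional (fst P). bij_betw L (fst P) {1..card (fst P)} \<and>
        (\<forall>u\<in>fst P. \<forall>v\<in>fst P. (u, v) \<in> snd P \<longrightarrow> L u < L v)}"

definition F :: "'a poset \<Rightarrow> 'a \<Rightarrow> 'a \<Rightarrow> 'a \<Rightarrow> int \<Rightarrow> int \<Rightarrow> nat" where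
  "F P x y z a b =
     card {L \<in> linear_extensions P. int (L y) - int (L x) = a \<and> int (L z) - int (L y) = b}"

end

theory Submission
  imports Defs
begin

text \<open>No linear extension has \<open>L y - L x = 1\<close> and \<open>L z - L y = - 1\<close>, since that would force
  \<open>L z = L x\<close>; hence \<open>F(1, -1) = 0\<close> in every poset. It therefore suffices that \<open>x, y, z\<close> can occur
  consecutively both in this and in the reverse order, for then
  \<open>F(-1, -1) F(1, 1) > 0 = F(1, -1) F(-1, 1)\<close>. This happens for a three-element antichain with a
  chain of arbitrary length placed above it.\<close>

text \<open>Extensionality confines the maps to a finite function space. This matters because
  \<open>card\<close> of an infinite set is 0, so one witness makes \<open>F\<close> positive only
  if the counted set is finite.\<close>

lemma finite_linear_extensions:
  assumes "finite (fst P)"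
  shows "finite (linear_extensions P)"
proof (rule finite_subset)
  show "linear_extensions P \<subseteq> (\<Pi>\<^sub>E u\<in>fst P. {1..card (fst P)})"
    by (auto simp: linear_extensions_def PiE_def bij_betw_def)
  show "finite (\<Pi>\<^sub>E u\<in>fst P. {1..card (fst P)})"
    using assms by (intro finite_PiE) auto
qed

lemma F_pos:
  assumes "finite (fst P)" "L \<in> linear_extensions P"
    and "int (L y) - int (L x) = a" "int (L z) - int (L y) = b"
  shows "F P x y z a b > 0"
  unfolding F_def using assms finite_linear_extensions[OF assms(1)]
  by (auto simp: card_gt_0_iff)

text \<open>The two differences telescope to \<open>L z - L x = a + b\<close>, so a zero sum
  contradicts injectivity of \<open>L\<close>.\<close>

lemma F_eq_0_if_sum_0:
  assumes "x \<in> fst P" "z \<in> fst P" "x \<noteq> z" "a + b = 0"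
  shows "F P x y z a b = 0"
proof -
  have False if "L \<in> linear_extensions P"
    "int (L y) - int (L x) = a" "int (L z) - int (L y) = b" for L
  proof -
    have "L x = L z" using that assms(4) by linarith
    then show False
      using that(1) assms by (auto simp: linear_extensions_def bij_betw_def dest: inj_onD)
  qed
  then show ?thesis unfolding F_def by (auto simp: card_eq_0_iff)
qed

text \<open>\<open>L\<close> is counted by \<open>F(1, 1)\<close> and \<open>M\<close> by
  \<open>F(-1, -1)\<close>; on the right one vanishing factor suffices.\<close>

lemma F_violation:
  assumes "finite (fst P)" "x \<in> fst P" "z \<in> fst P" "x \<noteq> z"
    and "L \<in> linear_extensions P" "L y = L x + 1" "L z = L y + 1"
    and "M \<in> linear_extensions P" "M y = M z + 1" "M x = M y + 1"
  shows "F P x y z (-1) (-1) * F P x y z 1 1 > F P x y z 1 (-1) * F P x y z (-1) 1"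
proof -
  have "F P x y z 1 1 > 0" by (rule F_pos[of P L]) (use assms in auto)
  moreover have "F P x y z (-1) (-1) > 0" by (rule F_pos[of P M]) (use assms in auto)
  moreover have "F P x y z 1 (-1) = 0" by (rule F_eq_0_if_sum_0) (use assms in auto)
  ultimately show ?thesis by simp
qed

lemma card_eq_if_poset_isomorphic:
  "poset_isomorphic P Q \<Longrightarrow> card (fst P) = card (fst Q)"
  by (auto simp: poset_isomorphic_def bij_betw_same_card)

text \<open>The ordinal sum of the antichain 0, 1, 2 and, above it, the chain 3, ..., n + 2: a pair
  is related exactly when its larger number lies in the chain.\<close>

definition antichain_chain :: "nat \<Rightarrow> nat poset" where
  "antichain_chain n = ({..<n + 3}, {(u, v). u < v \<and> 3 \<le> v \<and> v < n + 3})"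

lemma fst_antichain_chain [simp]: "fst (antichain_chain n) = {..<n + 3}"
  by (simp add: antichain_chain_def)

lemma finite_poset_antichain_chain: "finite_poset (antichain_chain n)"
  by (auto simp: finite_poset_def antichain_chain_def irrefl_def trans_def)

lemma width_antichain_chain: "width (antichain_chain n) = 3"
proof -
  let ?P = "antichain_chain n"
  have le: "card A \<le> 3" if A: "A \<in> antichains ?P" for A
  proof (cases "A \<subseteq> {..<3}")
    case True
    then show ?thesis using card_mono[of "{..<3::nat}" A] by simp
  next
    case False
    then obtain v where v: "v \<in> A" "3 \<le> v" by force
    \<comment> \<open>A chain element is comparable to every other element, so an antichain
      containing one is a singleton.\<close>
    have "u = v" if "u \<in> A" for u
    proof (rule ccontr)
      assume "u \<noteq> v"
      then have "(u, v) \<in> snd ?P \<or> (v, u) \<in> snd ?P"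
        using that v A by (auto simp: antichains_def antichain_chain_def)
      then show False using that v A by (auto simp: antichains_def)
    qed
    then have "A = {v}" using v by blast
    then show ?thesis by simp
  qed
  have "{..<3} \<in> antichains ?P"
    by (auto simp: antichains_def antichain_chain_def)
  then have "3 \<in> card ` antichains ?P" by force
  moreover have "finite (antichains ?P)"
    by (rule finite_subset[of _ "Pow {..<n + 3}"]) (auto simp: antichains_def)
  ultimately show ?thesis
    unfolding width_def using le by (intro Max_eqI) auto
qed

text \<open>The bottom elements are mutually unrelated, so any permutation of them is allowed.
  Adding 1 makes labels start at 1; bottom labels stay at most 3 and chain labels are at least
  4.\<close>

lemma linear_extension_antichain_chain:
  assumes "bij_betw g {..<3} {..<3}"
  shows "(\<lambda>i\<in>{..<n + 3}. if i < 3 then g i + 1 else i + 1) \<in> linear_extensions (antichain_chain n)"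
    (is "restrict ?f _ \<in> _")
proof -
  have g: "g i < 3" if "i < 3" for i
    using assms that by (auto dest: bij_betwE)
  have "inj_on ?f {..<n + 3}"
    using bij_betw_imp_inj_on[OF assms] by (auto simp: inj_on_def dest: g)
  moreover have sub: "?f ` {..<n + 3} \<subseteq> {1..n + 3}"
    by (auto dest: g)
  \<comment> \<open>Surjectivity by counting: an injective image inside a set of the same finite
    size.\<close>
  ultimately have "?f ` {..<n + 3} = {1..n + 3}"
    by (intro card_subset_eq) (simp_all only: card_image card_lessThan card_atLeastAtMost, simp_all)
  with \<open>inj_on ?f _\<close> have "bij_betw (restrict ?f {..<n + 3}) {..<n + 3} {1..n + 3}"
    by (simp only: bij_betw_def inj_on_restrict_eq image_restrict_eq)
  moreover have "?f u < ?f v" if "u < v" "3 \<le> v" for u v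
    using that g[of u] by auto
  ultimately show ?thesis
    unfolding linear_extensions_def by (simp add: antichain_chain_def)
qed

theorem theorem1p6:
  shows "\<exists>S :: nat poset set.
    infinite S \<and>
    (\<forall>P\<in>S. \<forall>Q\<in>S. P \<noteq> Q \<longrightarrow> \<not> poset_isomorphic P Q) \<and>
    (\<forall>P\<in>S. finite_poset P \<and> width P = 3 \<and>
      (\<exists>x y z. x \<in> fst P \<and> y \<in> fst P \<and> z \<in> fst P \<and> x \<noteq> y \<and> y \<noteq> z \<and> x \<noteq> z \<and>
        (\<exists>k p l q :: int. k \<le> p \<and> l \<le> q \<and>
          F P x y z k l * F P x y z p q > F P x y z p l * F P x y z k q)))"
proof (intro exI[of _ "range antichain_chain"] conjI ballI impI)
  have "inj antichain_chain"
    by (rule injI) (auto simp: antichain_chain_def)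
  then show "infinite (range antichain_chain)"
    by (simp add: finite_image_iff)
next
  fix P Q assume "P \<in> range antichain_chain" "Q \<in> range antichain_chain" "P \<noteq> Q"
  \<comment> \<open>Different \<open>n\<close> give ground sets of different size
    \<open>n + 3\<close>.\<close>
  then show "\<not> poset_isomorphic P Q"
    by (auto dest: card_eq_if_poset_isomorphic)
next
  fix P assume "P \<in> range antichain_chain"
  then obtain n where P: "P = antichain_chain n" by auto
  show "finite_poset P" "width P = 3"
    by (simp_all add: P finite_poset_antichain_chain width_antichain_chain)
  \<comment> \<open>Identity and reversal label 0, 1, 2 by 1, 2, 3 and by 3, 2, 1; the subtraction
    never truncates for \<open>i < 3\<close>.\<close>
  have "bij_betw (\<lambda>i::nat. i) {..<3} {..<3}" "bij_betw (\<lambda>i::nat. 2 - i) {..<3} {..<3}"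
    by (rule bij_betwI[where g = "\<lambda>i. i"]; simp)
      (rule bij_betwI[where g = "\<lambda>i. 2 - i"]; auto)
  note ext = this[THEN linear_extension_antichain_chain[of _ n]]
  have "F P 0 1 2 (-1) (-1) * F P 0 1 2 1 1 > F P 0 1 2 1 (-1) * F P 0 1 2 (-1) 1"
    unfolding P by (rule F_violation[OF _ _ _ _ ext(1) _ _ ext(2)]) auto
  moreover have "0 \<in> fst P" "1 \<in> fst P" "2 \<in> fst P" by (simp_all add: P)
  ultimately show "\<exists>x y z. x \<in> fst P \<and> y \<in> fst P \<and> z \<in> fst P \<and> x \<noteq> y \<and> y \<noteq> z \<and> x \<noteq> z \<and>
      (\<exists>k p l q :: int. k \<le> p \<and> l \<le> q \<and>
        F P x y z k l * F P x y z p q > F P x y z p l * F P x y z k q)"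
    by - (rule exI[of _ 0], rule exI[of _ 1], rule exI[of _ 2], intro conjI,
        simp_all, rule exI[of _ "- 1"], rule exI[of _ 1], simp,
        rule exI[of _ "- 1"], rule exI[of _ 1], simp)
qed

end
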